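(* Let $n, k, d$ be positive integers with $k \ge 2$, $k$ even, $n$ divisible by $k$, and $n > 2k$. Let $f_1,\dots,f_n \in \mathbb{R}^d$ be unit vectors (a batch of $n$ normalized embeddings), and suppose each sample $i \in \{1,\dots,n\}$ carries a class label such that every class occurring in the batch contains exactly $k$ of the $n$ samples. Let $s_{ij} = \langle f_i, f_j\rangle$, let $y_{ij} = 1$ if samples $i$ and $j$ have the same label and $y_{ij}=0$ otherwise, and let $\mathcal{L}_{\text{context}}$ be the contextual loss of the batch (defined in the context) with margin $\epsilon = 0$. Then $\mathcal{L}_{\text{context}} = 0$ if and only if for every $i \in \{1,\dots,n\}$ and all $p, j \in \{1,\dots,n\}$ with $y_{ip} = 1$ and $y_{ij} = 0$ one has $s_{ip} > s_{ij}$ (that is, all samples are correctly ranked with respect to every other sample within the batch).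
   Context: All sums run over indices in $\{1,\dots,n\}$. The contextual loss with margin $\epsilon = 0$ is defined as follows. Distances: $D(i,j) = 2 - 2 s_{ij}$, the squared Euclidean distance between $f_i$ and $f_j$. Neighborhood indicators: for a positive integer $m \le n$, let $\mathbb{1}_{\mathcal{N}_m}(i,j) = 1$ if $D(i,j) \le D(i,q)$, where $q$ is the $m$-th closest neighbor of $i$, and $\mathbb{1}_{\mathcal{N}_m}(i,j) = 0$ otherwise. The sample $i$ itself is included in the closest-neighbor count, so $D(i,q)$ is the $m$-th smallest value, counted with multiplicity, of the list $D(i,1),\dots,D(i,n)$, which includes $D(i,i)=0$. Intersection of neighborhoods: $$M_+(i,j) = \sum_{p} \mathbb{1}_{\mathcal{N}_k}(i,p)\,\mathbb{1}_{\mathcal{N}_k}(j,p), \qquad M_-(i,j) = \sum_{p} \bigl(1-\mathbb{1}_{\mathcal{N}_k}(i,p)\bigr)\bigl(1-\mathbb{1}_{\mathcal{N}_k}(j,p)\bigr),$$ $$W_1(i,j) = \frac{\mathbb{1}_{\mathcal{N}_k}(i,j)}{2}\left(\frac{M_+(i,j)}{\sum_p \mathbb{1}_{\mathcal{N}_k}(i,p)} + \frac{M_-(i,j)}{\sum_p \bigl(1-\mathbb{1}_{\mathcal{N}_k}(i,p)\bigr)}\right).$$ If the denominator $\sum_p (1-\mathbb{1}_{\mathcal{N}_k}(i,p))$ is $0$ (possible only in the presence of ties), then $M_-(i,j)=0$ as well and the second fraction is read as $0$. Query expansion: $$\mathbb{1}_{\mathcal{R}_{k/2}}(i,j) = \mathbb{1}_{\mathcal{N}_{k/2}}(i,j)\,\mathbb{1}_{\mathcal{N}_{k/2}}(j,i),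 \qquad W_2(i,j) = \frac{\sum_p \mathbb{1}_{\mathcal{R}_{k/2}}(i,p)\, W_1(p,j)}{\sum_p \mathbb{1}_{\mathcal{R}_{k/2}}(i,p)},$$ $$w_{ij} = \tfrac12\bigl(W_2(i,j) + W_2(j,i)\bigr).$$ Contextual loss: $$\mathcal{L}_{\text{context}} = \frac{1}{n^2}\sum_{\substack{i,j\\ i\ne j}} (y_{ij} - w_{ij})^2 .$$ *)

theory Defs
  imports "HOL-Analysis.Analysis"
begin

text \<open>A batch is a family \<open>f\<close> of vectors indexed by \<open>{1..n}\<close>; values of \<open>f\<close> outside this range are
  irrelevant.\<close>

definition sim :: "(nat \<Rightarrow> real ^ 'd) \<Rightarrow> nat \<Rightarrow> nat \<Rightarrow> real" where
  "sim f i j = f i \<bullet> f j"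

text \<open>For unit vectors this is the squared Euclidean distance.\<close>

definition D :: "(nat \<Rightarrow> real ^ 'd) \<Rightarrow> nat \<Rightarrow> nat \<Rightarrow> real" where
  "D f i j = 2 - 2 * sim f i j"

text \<open>The distance from \<open>i\<close> to its \<open>m\<close>-th closest neighbour, \<open>1 \<le> m \<le> n\<close>: the \<open>m\<close>-th smallest entry,
  with multiplicity, of \<open>D(i,1), \<dots>, D(i,n)\<close>, where \<open>D(i,i)\<close> is not omitted.  List positions
  start at 0.\<close>

definition nth_dist :: "nat \<Rightarrow> (nat \<Rightarrow> real ^ 'd) \<Rightarrow> nat \<Rightarrow> nat \<Rightarrow> real" where
  "nth_dist n f m i = sort (map (D f i) [1..<Suc n]) ! (m - 1)"

definition nbh :: "nat \<Rightarrow> (nat \<Rightarrow> real ^ 'd) \<Rightarrow> nat \<Rightarrow> nat \<Rightarrow> nat \<Rightarrow> real" where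
  "nbh n f m i j = (if D f i j \<le> nth_dist n f m i then 1 else 0)"

definition M_plus :: "nat \<Rightarrow> nat \<Rightarrow> (nat \<Rightarrow> real ^ 'd) \<Rightarrow> nat \<Rightarrow> nat \<Rightarrow> real" where
  "M_plus n k f i j = (\<Sum>p = 1..n. nbh n f k i p * nbh n f k j p)"

definition M_minus :: "nat \<Rightarrow> nat \<Rightarrow> (nat \<Rightarrow> real ^ 'd) \<Rightarrow> nat \<Rightarrow> nat \<Rightarrow> real" where
  "M_minus n k f i j = (\<Sum>p = 1..n. (1 - nbh n f k i p) * (1 - nbh n f k j p))"

text \<open>With ties, all of \<open>{1..n}\<close> may be neighbours of \<open>i\<close>; the second fraction is then \<open>0 / 0 = 0\<close>,
  which is the intended convention.\<close>

definition W1 :: "nat \<Rightarrow> nat \<Rightarrow> (nat \<Rightarrow> real ^ 'd) \<Rightarrow> nat \<Rightarrow> nat \<Rightarrow> real" where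
  "W1 n k f i j = nbh n f k i j / 2 *
     (M_plus n k f i j / (\<Sum>p = 1..n. nbh n f k i p) +
      M_minus n k f i j / (\<Sum>p = 1..n. 1 - nbh n f k i p))"

definition recip :: "nat \<Rightarrow> (nat \<Rightarrow> real ^ 'd) \<Rightarrow> nat \<Rightarrow> nat \<Rightarrow> nat \<Rightarrow> real" where
  "recip n f m i j = nbh n f m i j * nbh n f m j i"

definition W2 :: "nat \<Rightarrow> nat \<Rightarrow> (nat \<Rightarrow> real ^ 'd) \<Rightarrow> nat \<Rightarrow> nat \<Rightarrow> real" where
  "W2 n k f i j =
     (\<Sum>p = 1..n. recip n f (k div 2) i p * W1 n k f p j) / (\<Sum>p = 1..n. recip n f (k div 2) i p)"

definition w :: "nat \<Rightarrow> nat \<Rightarrow> (nat \<Rightarrow> real ^ 'd) \<Rightarrow> nat \<Rightarrow> nat \<Rightarrow> real" where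
  "w n k f i j = 1 / 2 * (W2 n k f i j + W2 n k f j i)"

definition same_label :: "(nat \<Rightarrow> 'c) \<Rightarrow> nat \<Rightarrow> nat \<Rightarrow> real" where
  "same_label lab i j = (if lab i = lab j then 1 else 0)"

definition context_loss :: "nat \<Rightarrow> nat \<Rightarrow> (nat \<Rightarrow> real ^ 'd) \<Rightarrow> (nat \<Rightarrow> 'c) \<Rightarrow> real" where
  "context_loss n k f lab =
     1 / (real n)\<^sup>2 * (\<Sum>i = 1..n. \<Sum>j \<in> {1..n} - {i}. (same_label lab i j - w n k f i j)\<^sup>2)"

end

theory Submission
  imports Defs
begin

text \<open>The idea: \<open>W2 i j\<close> is an average of values \<open>W1 p j \<in> [0, 1]\<close> in which the term \<open>p = i\<close> has
  positive weight, because \<open>i\<close> is among its own nearest neighbours.  Hence \<open>w i j \<in> {0, 1}\<close> forces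
  \<open>W1 i j = w i j\<close>.  Moreover \<open>W1 i j\<close> vanishes exactly when \<open>j\<close> is not among the \<open>k\<close> nearest
  neighbours of \<open>i\<close>, since \<open>j\<close> always belongs to its own neighbourhood.  So a vanishing loss makes the
  \<open>k\<close>-neighbourhood of every sample equal to its class, which is a correct ranking.  Conversely, for
  a correct ranking the \<open>k\<close>-neighbourhoods are the classes, as these have \<open>k\<close> elements, and all
  weights can be read off.\<close>

section \<open>Order statistics and neighbourhood indicators\<close>

text \<open>The entries below \<open>x\<close> form an initial segment of the sorted list, and
  position \<open>m\<close> lies outside it exactly when its length is at most
  \<open>m\<close>.\<close>

lemma le_nth_sorted_iff:
  fixes xs :: "'a::linorder list"
  assumes "sorted xs" and "m < length xs"
  shows "x \<le> xs ! m \<longleftrightarrow> length (filter (\<lambda>y. y < x) xs) \<le> m"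
  using assms
proof (induction xs arbitrary: m)
  case (Cons y ys)
  show ?case
  proof (cases "y < x")
    case True
    then show ?thesis using Cons by (cases m) auto
  next
    case False
    then have ge: "\<forall>z \<in> set (y # ys). x \<le> z" using Cons.prems(1) by fastforce
    then have "filter (\<lambda>z. z < x) (y # ys) = []" by (auto simp: filter_empty_conv)
    moreover have "x \<le> (y # ys) ! m" using ge Cons.prems(2) nth_mem by blast
    ultimately show ?thesis by simp
  qed
qed simp

text \<open>Sorting preserves the number of entries below \<open>x\<close>. This trades the sorted
  list for a cardinality, whose strict inequality takes care of ties.\<close>

lemma le_nth_dist_iff:
  assumes "0 < m" and "m \<le> n"
  shows "x \<le> nth_dist n f m i \<longleftrightarrow> card {q \<in> {1..n}. D f i q < x} < m"
proof -
  let ?xs = "map (D f i) [1..<Suc n]"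
  have "length (filter (\<lambda>y. y < x) (sort ?xs)) = length (filter (\<lambda>q. D f i q < x) [1..<Suc n])"
    by (simp add: filter_sort filter_map comp_def del: upt_Suc)
  also have "\<dots> = card (set (filter (\<lambda>q. D f i q < x) [1..<Suc n]))"
    by (rule distinct_card [symmetric]) simp
  also have "set (filter (\<lambda>q. D f i q < x) [1..<Suc n]) = {q \<in> {1..n}. D f i q < x}"
    by auto
  finally have eq: "length (filter (\<lambda>y. y < x) (sort ?xs)) = card {q \<in> {1..n}. D f i q < x}" .
  have "x \<le> nth_dist n f m i \<longleftrightarrow> length (filter (\<lambda>y. y < x) (sort ?xs)) \<le> m - 1"
    unfolding nth_dist_def by (rule le_nth_sorted_iff) (use assms in simp_all)
  then show ?thesis unfolding eq using assms by linarith
qed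

lemma nbh_eq:
  assumes "0 < m" and "m \<le> n"
  shows "nbh n f m i j = (if card {q \<in> {1..n}. D f i q < D f i j} < m then 1 else 0)"
  unfolding nbh_def le_nth_dist_iff [OF assms] ..

lemma nbh_range: "0 \<le> nbh n f m i j" "nbh n f m i j \<le> 1"
  by (simp_all add: nbh_def)

text \<open>By Cauchy-Schwarz no unit vector is strictly closer to \<open>f i\<close> than
  \<open>f i\<close> itself.\<close>

lemma nbh_self:
  assumes "0 < m" and "m \<le> n" and "\<forall>i \<in> {1..n}. norm (f i) = 1" and "i \<in> {1..n}"
  shows "nbh n f m i i = 1"
proof -
  have "\<not> D f i q < D f i i" if "q \<in> {1..n}" for q
    using norm_cauchy_schwarz [of "f i" "f q"] assms(3,4) that
    by (simp add: D_def sim_def dot_square_norm)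
  then have "{q \<in> {1..n}. D f i q < D f i i} = {}" by blast
  then show ?thesis using assms(1) unfolding nbh_eq [OF assms(1,2)] by (simp only: card.empty if_True)
qed

lemma nbh_mono:
  assumes "0 < m" and "m \<le> m'" and "m' \<le> n"
  shows "nbh n f m i j \<le> nbh n f m' i j"
  using assms by (simp add: nbh_eq)

section \<open>Bounds on the weights\<close>

lemma recip_nonneg: "0 \<le> recip n f m i j"
  by (simp add: recip_def nbh_range)

lemma M_nonneg: "0 \<le> M_plus n k f i j" "0 \<le> M_minus n k f i j"
  unfolding M_plus_def M_minus_def by (auto intro!: sum_nonneg simp: nbh_range)

lemma W1_nonneg: "0 \<le> W1 n k f i j"
  unfolding W1_def
  by (intro mult_nonneg_nonneg add_nonneg_nonneg divide_nonneg_nonneg sum_nonneg M_nonneg)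
    (simp_all add: nbh_range)

text \<open>Bounding the second factor of each summand of \<open>M_plus\<close> and
  \<open>M_minus\<close> by 1 leaves the denominators, so both fractions are at most 1, also when a
  denominator is 0.\<close>

lemma W1_le_nbh: "W1 n k f i j \<le> nbh n f k i j"
proof -
  let ?a = "\<Sum>p = 1..n. nbh n f k i p" and ?b = "\<Sum>p = 1..n. 1 - nbh n f k i p"
  have "M_plus n k f i j \<le> ?a"
    unfolding M_plus_def by (rule sum_mono) (simp add: nbh_range mult_left_le)
  moreover have "0 \<le> ?a" by (simp add: sum_nonneg nbh_range)
  ultimately have 1: "M_plus n k f i j / ?a \<le> 1" by (auto simp: divide_le_eq_1)
  have "M_minus n k f i j \<le> ?b"
    unfolding M_minus_def by (rule sum_mono) (simp add: nbh_range mult_left_le)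
  moreover have "0 \<le> ?b" by (rule sum_nonneg) (simp add: nbh_range)
  ultimately have 2: "M_minus n k f i j / ?b \<le> 1" by (auto simp: divide_le_eq_1)
  have "W1 n k f i j \<le> nbh n f k i j / 2 * 2"
    unfolding W1_def using 1 2 by (intro mult_left_mono) (simp_all add: nbh_range)
  then show ?thesis by simp
qed

text \<open>The summand \<open>p = j\<close> of \<open>M_plus\<close> is 1 because \<open>j\<close>
  is its own neighbour, so the first fraction is already positive.\<close>

lemma W1_pos:
  assumes "0 < k" and "k \<le> n" and "\<forall>i \<in> {1..n}. norm (f i) = 1"
    and "i \<in> {1..n}" and "j \<in> {1..n}" and "nbh n f k i j = 1"
  shows "0 < W1 n k f i j"
proof -
  have "nbh n f k i j * nbh n f k j j \<le> M_plus n k f i j"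
    unfolding M_plus_def using assms(5) by (intro member_le_sum) (auto simp: nbh_range)
  then have 1: "0 < M_plus n k f i j" using nbh_self [OF assms(1-3,5)] assms(6) by simp
  have "nbh n f k i j \<le> (\<Sum>p = 1..n. nbh n f k i p)"
    using assms(5) by (intro member_le_sum) (auto simp: nbh_range)
  then have "0 < M_plus n k f i j / (\<Sum>p = 1..n. nbh n f k i p)" using 1 assms(6) by simp
  moreover have "0 \<le> M_minus n k f i j / (\<Sum>p = 1..n. 1 - nbh n f k i p)"
    by (intro divide_nonneg_nonneg sum_nonneg M_nonneg) (simp add: nbh_range)
  ultimately show ?thesis unfolding W1_def assms(6) by simp
qed

lemma weighted_average_extreme:
  fixes u v :: "'a \<Rightarrow> real"
  assumes "finite A" and "a \<in> A" and "0 < u a"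
    and u: "\<And>x. x \<in> A \<Longrightarrow> 0 \<le> u x" and v: "\<And>x. x \<in> A \<Longrightarrow> 0 \<le> v x \<and> v x \<le> 1"
  defines "avg \<equiv> (\<Sum>x \<in> A. u x * v x) / (\<Sum>x \<in> A. u x)"
  shows "0 \<le> avg" and "avg \<le> 1" and "avg = 0 \<Longrightarrow> v a = 0" and "avg = 1 \<Longrightarrow> v a = 1"
proof -
  have pos: "0 < (\<Sum>x \<in> A. u x)" using sum_pos2 [of A a u] assms(1-3) u by blast
  have le: "(\<Sum>x \<in> A. u x * v x) \<le> (\<Sum>x \<in> A. u x)"
    using u v by (intro sum_mono mult_left_le) auto
  have nn: "0 \<le> (\<Sum>x \<in> A. u x * v x)" using u v by (intro sum_nonneg) auto
  show "0 \<le> avg" "avg \<le> 1" unfolding avg_def using pos le nn by (auto simp: divide_le_eq_1)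
  show "v a = 0" if "avg = 0"
  proof -
    have "(\<Sum>x \<in> A. u x * v x) = 0" using that pos unfolding avg_def by simp
    then have "u a * v a = 0"
      using u v assms(1,2) by (subst (asm) sum_nonneg_eq_0_iff) auto
    then show ?thesis using assms(3) by simp
  qed
  show "v a = 1" if "avg = 1"
  proof -
    \<comment> \<open>Replacing \<open>v\<close> by \<open>1 - v\<close> turns the average into
      \<open>1 - avg\<close>, so the argument for 0 applies again.\<close>
    have "(\<Sum>x \<in> A. u x * (1 - v x)) = 0"
      using that pos unfolding avg_def by (simp add: right_diff_distrib sum_subtractf)
    then have "u a * (1 - v a) = 0"
      using u v assms(1,2) by (subst (asm) sum_nonneg_eq_0_iff) auto
    then show ?thesis using assms(3) by simp
  qed
qed

text \<open>The index singled out in the average is \<open>p = i\<close>; its weight is positive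
  because \<open>2 \<le> k\<close> gives \<open>0 < k div 2\<close>.\<close>

lemma W2_extreme:
  assumes "2 \<le> k" and "k \<le> n" and "\<forall>i \<in> {1..n}. norm (f i) = 1" and "i \<in> {1..n}"
  shows "0 \<le> W2 n k f i j" and "W2 n k f i j \<le> 1"
    and "W2 n k f i j = 0 \<Longrightarrow> W1 n k f i j = 0"
    and "W2 n k f i j = 1 \<Longrightarrow> W1 n k f i j = 1"
proof -
  have "nbh n f (k div 2) i i = 1" using assms by (intro nbh_self) auto
  then have "0 < recip n f (k div 2) i i" by (simp add: recip_def)
  note avg = weighted_average_extreme [where u = "recip n f (k div 2) i" and v = "\<lambda>p. W1 n k f p j",
      OF finite_atLeastAtMost assms(4) this recip_nonneg]
  have "0 \<le> W1 n k f p j \<and> W1 n k f p j \<le> 1" for p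
    using W1_nonneg [of n k f p j] W1_le_nbh [of n k f p j] nbh_range(2) [of n f k p j] by linarith
  with avg show "0 \<le> W2 n k f i j" "W2 n k f i j \<le> 1"
    "W2 n k f i j = 0 \<Longrightarrow> W1 n k f i j = 0" "W2 n k f i j = 1 \<Longrightarrow> W1 n k f i j = 1"
    unfolding W2_def by auto
qed

section \<open>From vanishing loss to neighbourhoods\<close>

lemma context_loss_eq_0_iff:
  assumes "0 < n"
  shows "context_loss n k f lab = 0 \<longleftrightarrow>
    (\<forall>i \<in> {1..n}. \<forall>j \<in> {1..n} - {i}. w n k f i j = same_label lab i j)"
  using assms unfolding context_loss_def
  by (simp add: sum_nonneg_eq_0_iff sum_nonneg) (metis eq_commute)

lemma nbh_of_context_loss_eq_0:
  assumes "2 \<le> k" and "k \<le> n" and unit: "\<forall>i \<in> {1..n}. norm (f i) = 1"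
    and loss: "context_loss n k f lab = 0" and i: "i \<in> {1..n}" and j: "j \<in> {1..n}"
  shows "nbh n f k i j = same_label lab i j"
proof (cases "i = j")
  \<comment> \<open>The loss says nothing about the diagonal, so this case rests on the unit norms
    alone.\<close>
  case True
  then show ?thesis using nbh_self [of k n f i] assms by (simp add: same_label_def)
next
  case False
  then have w: "w n k f i j = same_label lab i j"
    using loss i j assms(1,2) by (subst (asm) context_loss_eq_0_iff) auto
  note W2 = W2_extreme [OF assms(1,2) unit]
  show ?thesis
  proof (cases "lab i = lab j")
    case True
    \<comment> \<open>A mean of two numbers bounded by 1 equals 1 only if both do; dually for 0 in
      the other case.\<close>
    then have "W2 n k f i j = 1"
      using w W2(2) [OF i, of j] W2(2) [OF j, of i] unfolding w_def same_label_def by simp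
    then have "W1 n k f i j = 1" by (rule W2(4) [OF i])
    then show ?thesis
      using True W1_le_nbh [of n k f i j] nbh_range(2) [of n f k i j]
      by (simp add: same_label_def)
  next
    assume diff: "lab i \<noteq> lab j"
    then have "W2 n k f i j = 0"
      using w W2(1) [OF i, of j] W2(1) [OF j, of i] unfolding w_def same_label_def by simp
    then have "W1 n k f i j = 0" by (rule W2(3) [OF i])
    then have "nbh n f k i j \<noteq> 1" using W1_pos [of k n f i j] assms by auto
    then show ?thesis using diff by (simp add: same_label_def nbh_def split: if_splits)
  qed
qed

section \<open>From correct ranking to vanishing loss\<close>

lemma nbh_of_correct_ranking:
  assumes "0 < k" and "k \<le> n" and i: "i \<in> {1..n}" and j: "j \<in> {1..n}"
    and cls: "card {p \<in> {1..n}. lab p = lab i} = k"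
    and rank: "\<And>p q. \<lbrakk>p \<in> {1..n}; q \<in> {1..n}; lab i = lab p; lab i \<noteq> lab q\<rbrakk>
      \<Longrightarrow> sim f i q < sim f i p"
  shows "nbh n f k i j = same_label lab i j"
proof (cases "lab i = lab j")
  case True
  \<comment> \<open>The inclusion is proper because \<open>j\<close> is in the class but not
    strictly closer than itself; hence fewer than \<open>k\<close> samples precede
    \<open>j\<close>.\<close>
  have "{q \<in> {1..n}. D f i q < D f i j} \<subset> {p \<in> {1..n}. lab p = lab i}"
  proof
    show "{q \<in> {1..n}. D f i q < D f i j} \<subseteq> {p \<in> {1..n}. lab p = lab i}"
      using rank [OF j _ True] unfolding D_def by force
    show "{q \<in> {1..n}. D f i q < D f i j} \<noteq> {p \<in> {1..n}. lab p = lab i}"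
      using j True by force
  qed
  then have "card {q \<in> {1..n}. D f i q < D f i j} < card {p \<in> {1..n}. lab p = lab i}"
    by (intro psubset_card_mono) auto
  then show ?thesis using cls True by (simp add: nbh_eq [OF assms(1,2)] same_label_def)
next
  case False
  have "{p \<in> {1..n}. lab p = lab i} \<subseteq> {q \<in> {1..n}. D f i q < D f i j}"
    using rank [OF _ j _ False] unfolding D_def by force
  then have "card {p \<in> {1..n}. lab p = lab i} \<le> card {q \<in> {1..n}. D f i q < D f i j}"
    by (intro card_mono) auto
  then show ?thesis using cls False by (simp add: nbh_eq [OF assms(1,2)] same_label_def)
qed

text \<open>Samples of one class have the same neighbourhood, so by idempotence of the indicators
  each numerator equals its denominator.\<close>

lemma W1_of_nbh_eq_same_label:
  assumes "0 < k" and "k < n" and i: "i \<in> {1..n}" and j: "j \<in> {1..n}"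
    and cls: "card {p \<in> {1..n}. lab p = lab i} = k"
    and nbh: "\<And>i p. \<lbrakk>i \<in> {1..n}; p \<in> {1..n}\<rbrakk> \<Longrightarrow> nbh n f k i p = same_label lab i p"
  shows "W1 n k f i j = same_label lab i j"
proof (cases "lab i = lab j")
  case False
  then show ?thesis using nbh [OF i j] by (simp add: W1_def same_label_def)
next
  case True
  have eq: "nbh n f k j p = nbh n f k i p" if "p \<in> {1..n}" for p
    using nbh [OF i that] nbh [OF j that] True by (simp add: same_label_def)
  have idem: "nbh n f k i p * nbh n f k i p = nbh n f k i p"
    "(1 - nbh n f k i p) * (1 - nbh n f k i p) = 1 - nbh n f k i p" for p
    by (simp_all add: nbh_def)
  have M: "M_plus n k f i j = (\<Sum>p = 1..n. nbh n f k i p)"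
    "M_minus n k f i j = (\<Sum>p = 1..n. 1 - nbh n f k i p)"
    unfolding M_plus_def M_minus_def by (auto intro!: sum.cong simp: eq idem)
  have "(\<Sum>p = 1..n. nbh n f k i p) = (\<Sum>p = 1..n. if lab p = lab i then 1 else 0)"
    using nbh [OF i] by (intro sum.cong) (auto simp: same_label_def)
  also have "\<dots> = real k"
    by (subst sum.inter_filter [symmetric]) (simp_all only: finite_atLeastAtMost sum_constant cls mult_1_right)
  finally have sum: "(\<Sum>p = 1..n. nbh n f k i p) = real k" .
  \<comment> \<open>Nonzero since \<open>k < n\<close>; otherwise the second fraction would be read
    as 0 and \<open>W1\<close> would be only 1/2.\<close>
  have "(\<Sum>p = 1..n. 1 - nbh n f k i p) = real n - real k"
    by (simp only: sum_subtractf sum) simp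
  then show ?thesis
    unfolding W1_def M sum using sum assms(1,2) nbh [OF i j] True by (simp add: same_label_def)
qed

text \<open>Reciprocal neighbours of \<open>i\<close> lie in its \<open>k\<close>-neighbourhood,
  hence in its class, where \<open>W1 n k f p j\<close> does not depend on \<open>p\<close>. The
  average is thus over a constant.\<close>

lemma W2_of_nbh_eq_same_label:
  assumes "2 \<le> k" and "k < n" and unit: "\<forall>i \<in> {1..n}. norm (f i) = 1"
    and i: "i \<in> {1..n}" and j: "j \<in> {1..n}"
    and cls: "\<And>i. i \<in> {1..n} \<Longrightarrow> card {p \<in> {1..n}. lab p = lab i} = k"
    and nbh: "\<And>i p. \<lbrakk>i \<in> {1..n}; p \<in> {1..n}\<rbrakk> \<Longrightarrow> nbh n f k i p = same_label lab i p"
  shows "W2 n k f i j = same_label lab i j"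
proof -
  let ?r = "recip n f (k div 2) i"
  have "?r p * W1 n k f p j = ?r p * same_label lab i j" if p: "p \<in> {1..n}" for p
  proof (cases "lab i = lab p")
    case True
    then show ?thesis
      using W1_of_nbh_eq_same_label [OF _ assms(2) p j cls [OF p] nbh] assms(1)
      by (simp add: same_label_def)
  next
    case False
    then have "nbh n f (k div 2) i p \<le> 0"
      using nbh_mono [of "k div 2" k n f i p] nbh [OF i p] assms(1,2) by (simp add: same_label_def)
    then show ?thesis using nbh_range(1) [of n f "k div 2" i p] by (simp add: recip_def)
  qed
  then have "(\<Sum>p = 1..n. ?r p * W1 n k f p j) = (\<Sum>p = 1..n. ?r p) * same_label lab i j"
    unfolding sum_distrib_right by (intro sum.cong refl)
  moreover have "nbh n f (k div 2) i i = 1" using assms by (intro nbh_self) auto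
  then have "0 < (\<Sum>p = 1..n. ?r p)"
    using i by (intro sum_pos2 [of _ i]) (auto simp: recip_def nbh_range)
  ultimately show ?thesis unfolding W2_def by simp
qed

theorem proposition4p1:
  fixes n k :: nat and f :: "nat \<Rightarrow> real ^ 'd" and lab :: "nat \<Rightarrow> 'c"
  assumes "n > 0" and "k \<ge> 2" and "even k" and "k dvd n" and "n > 2 * k"
    and "\<forall>i \<in> {1..n}. norm (f i) = 1"
    and "\<forall>c \<in> lab ` {1..n}. card {i \<in> {1..n}. lab i = c} = k"
  shows "context_loss n k f lab = 0 \<longleftrightarrow>
    (\<forall>i \<in> {1..n}. \<forall>p \<in> {1..n}. \<forall>j \<in> {1..n}.
       same_label lab i p = 1 \<and> same_label lab i j = 0 \<longrightarrow> sim f i p > sim f i j)"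
    (is "?loss \<longleftrightarrow> ?ranked")
proof
  have kn: "0 < k" "k < n" "k \<le> n" using assms(2,5) by auto
  show ?ranked if ?loss
  proof (intro ballI impI)
    fix i p j assume ipj: "i \<in> {1..n}" "p \<in> {1..n}" "j \<in> {1..n}"
      and "same_label lab i p = 1 \<and> same_label lab i j = 0"
    then have "nbh n f k i p = 1" "nbh n f k i j = 0"
      using nbh_of_context_loss_eq_0 [OF assms(2) kn(3) assms(6) \<open>?loss\<close>] by simp_all
    \<comment> \<open>The threshold \<open>nth_dist n f k i\<close> separates the two
      distances.\<close>
    then show "sim f i p > sim f i j"
      by (simp add: nbh_def D_def split: if_splits)
  qed
  show ?loss if ?ranked
  proof -
    have cls: "card {p \<in> {1..n}. lab p = lab i} = k" if "i \<in> {1..n}" for i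
      using assms(7) that by blast
    have "nbh n f k i j = same_label lab i j" if ij: "i \<in> {1..n}" "j \<in> {1..n}" for i j
      using \<open>?ranked\<close> ij(1)
      by (intro nbh_of_correct_ranking [OF kn(1,3) ij cls]) (auto simp: same_label_def)
    then have "W2 n k f i j = same_label lab i j" if "i \<in> {1..n}" "j \<in> {1..n}" for i j
      using W2_of_nbh_eq_same_label [OF assms(2) kn(2) assms(6) that cls] by blast
    then show ?thesis
      unfolding context_loss_eq_0_iff [OF assms(1)] by (auto simp: w_def same_label_def)
  qed
qed

end
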